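(* Let $d\ge2$ be an integer and $m>1$ real. Let $x_1,\dots,x_d$ be real numbers satisfying $\prod_{k=1}^d\sqrt{1+x_k^2}=m$ for which $\Delta=\prod_{1\le j<k\le d}(x_j-x_k)^2$ is maximal among all collections of $d$ real numbers satisfying this constraint, let $f(x)=\prod_{k=1}^d(x-x_k)$, and let $\lambda\in\mathbb{R}$ be the corresponding Lagrange multiplier. If $\lambda\ne2d-2$, then $\lambda>2d-3$ and $$f(x)=x^d+\sum_{k=1}^{\lfloor d/2\rfloor}\left(\binom{d}{2k}\prod_{j=1}^k\frac{2j-1}{2d-2j-1-\lambda}\right)x^{d-2k},$$ where $\lambda$ must satisfy the constraint equation $|f(i)|=m$. If $\lambda=2d-2$, then $$f(x)=\frac1{2d}\Big((d-Bi)(x+i)^d+(d+Bi)(x-i)^d\Big),$$ where $B\in\mathbb{R}$ is the coefficient of $x^{d-1}$ in $f$, and $B$ satisfies $|f(i)|=m$.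
   Context: The Lagrange multiplier $\lambda$ is the real number with $\nabla g=\lambda\nabla h$ at the point $(x_1,\dots,x_d)$ (whose coordinates are distinct, since $\Delta$ is maximal), where $$g(x_1,\dots,x_d)=\sum_{1\le j<k\le d}\log(x_j-x_k)^2,\qquad h(x_1,\dots,x_d)=\frac12\sum_{k=1}^d\log(1+x_k^2);$$ explicitly, $\sum_{j\ne k}\frac{2}{x_k-x_j}=\frac{\lambda x_k}{x_k^2+1}$ for $k=1,\dots,d$. Here $i=\sqrt{-1}$. *)

theory Defs
  imports "HOL-Analysis.Analysis" "HOL-Computational_Algebra.Polynomial"
begin

(* The d real numbers are the coordinates of a vector of type real ^ 'n with CARD('n) = d.
   The linear order on the index type serves only to write the index range j < k. *)

definition constraint_prod :: "real ^ 'n \<Rightarrow> real" where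
  "constraint_prod x = (\<Prod>k\<in>UNIV. sqrt (1 + (x $ k)\<^sup>2))"

definition discr :: "real ^ ('n :: {finite, linorder}) \<Rightarrow> real" where
  "discr x = (\<Prod>(j, k)\<in>{(j, k). j < k}. (x $ j - x $ k)\<^sup>2)"

definition maximizes_discr :: "real \<Rightarrow> real ^ ('n :: {finite, linorder}) \<Rightarrow> bool" where
  "maximizes_discr m x \<longleftrightarrow>
     constraint_prod x = m \<and> (\<forall>y :: real ^ ('n :: {finite, linorder}). constraint_prod y = m \<longrightarrow> discr y \<le> discr x)"

definition log_discr :: "real ^ ('n :: {finite, linorder}) \<Rightarrow> real" where
  "log_discr x = (\<Sum>(j, k)\<in>{(j, k). j < k}. ln ((x $ j - x $ k)\<^sup>2))"

definition log_constraint :: "real ^ 'n \<Rightarrow> real" where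
  "log_constraint x = 1 / 2 * (\<Sum>k\<in>UNIV. ln (1 + (x $ k)\<^sup>2))"

(* The existence of the gradient of log_discr at x forces the coordinates of x to be distinct:
   if two of them agree, log_discr is unbounded below near x (the convention ln 0 = 0 only
   affects its value on the diagonals). *)
definition lagrange_multiplier :: "real ^ ('n :: {finite, linorder}) \<Rightarrow> real \<Rightarrow> bool" where
  "lagrange_multiplier x lam \<longleftrightarrow>
     (\<exists>u v. GDERIV log_discr x :> u \<and> GDERIV log_constraint x :> v \<and> u = lam *\<^sub>R v)"

definition root_poly :: "real ^ 'n \<Rightarrow> real poly" where
  "root_poly x = (\<Prod>k\<in>UNIV. [:- (x $ k), 1:])"

definition cpoly :: "real poly \<Rightarrow> complex \<Rightarrow> complex" where
  "cpoly p z = poly (map_poly complex_of_real p) z"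

end

theory Submission
  imports Defs
begin

text \<open>Since the discriminant grows under dilation, a maximizer on the constraint surface is also a
  maximizer on the region it bounds. Hence every direction that decreases the constraint to first
  order does not increase the discriminant, which forces the two gradients to be parallel.
  The resulting equations at the roots turn into the differential equation
  \<open>(1 + X\<^sup>2) f'' - l X f' = d (d - 1 - l) f\<close>, that is, into a two-step recurrence for
  the coefficients of \<open>f\<close>. Unless \<open>l = 2 d - 2\<close>, the coefficient of \<open>X^(d - 1)\<close> is zero;
  the next coefficient is then minus half the sum of the squares of the roots, hence negative, and
  the first step of the recurrence gives \<open>l > 2 d - 3\<close>.\<close>

section \<open>Existence of the multiplier\<close>

lemma constraint_prod_pos: "constraint_prod x > 0"
  unfolding constraint_prod_def
  by (intro prod_pos) (auto intro: add_pos_nonneg)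

lemma ln_constraint_prod: "ln (constraint_prod x) = log_constraint x"
proof -
  have "ln (constraint_prod x) = (\<Sum>k\<in>UNIV. ln (sqrt (1 + (x $ k)\<^sup>2)))"
    unfolding constraint_prod_def
    by (intro ln_prod) (auto intro: add_pos_nonneg simp: add_pos_nonneg less_imp_neq[symmetric])
  also have "\<dots> = (\<Sum>k\<in>UNIV. 1 / 2 * ln (1 + (x $ k)\<^sup>2))"
    by (intro sum.cong refl) (simp add: ln_sqrt add_pos_nonneg)
  finally show ?thesis
    by (simp add: log_constraint_def sum_distrib_left)
qed

lemma discr_nonneg: "discr x \<ge> 0"
  unfolding discr_def by (intro prod_nonneg) auto

lemma discr_pos_iff: "discr x > 0 \<longleftrightarrow> (\<forall>j k. j \<noteq> k \<longrightarrow> x $ j \<noteq> x $ k)"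
proof -
  have "discr x \<noteq> 0 \<longleftrightarrow> (\<forall>j k. j < k \<longrightarrow> x $ j \<noteq> x $ k)"
    unfolding discr_def by (subst prod_zero_iff) auto
  also have "\<dots> \<longleftrightarrow> (\<forall>j k. j \<noteq> k \<longrightarrow> x $ j \<noteq> x $ k)"
    by (metis neq_iff)
  finally show ?thesis
    using discr_nonneg[of x] by (simp add: less_le)
qed

lemma ln_discr:
  assumes "discr x > 0"
  shows "ln (discr x) = log_discr x"
proof -
  have "ln (discr x) = (\<Sum>p\<in>{(j, k). j < k}. ln (case p of (j, k) \<Rightarrow> (x $ j - x $ k)\<^sup>2))"
    unfolding discr_def using assms[unfolded discr_pos_iff]
    by (intro ln_prod) (auto simp: less_imp_neq)
  then show ?thesis
    by (simp add: log_discr_def case_prod_unfold)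
qed

lemma discr_scaleR_mono:
  assumes "t \<ge> 1"
  shows "discr y \<le> discr (t *\<^sub>R y)"
  unfolding discr_def
proof (intro prod_mono, clarify, intro conjI)
  fix j k :: 'a
  have "(t *\<^sub>R y $ j - t *\<^sub>R y $ k)\<^sup>2 = t\<^sup>2 * (y $ j - y $ k)\<^sup>2"
    by (simp add: power2_eq_square algebra_simps)
  moreover have "t\<^sup>2 \<ge> 1"
    using assms by (simp add: one_le_power)
  ultimately show "(y $ j - y $ k)\<^sup>2 \<le> ((t *\<^sub>R y) $ j - (t *\<^sub>R y) $ k)\<^sup>2"
    using mult_right_mono[of 1 "t\<^sup>2" "(y $ j - y $ k)\<^sup>2"] by simp
qed simp

text \<open>All factors are at least 1, so the product dominates each single one. This makes the
  constraint unbounded along every ray through a nonzero vector.\<close>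

lemma constraint_prod_ge: "constraint_prod x \<ge> \<bar>x $ k\<bar>"
proof -
  have "\<bar>x $ k\<bar> \<le> sqrt (1 + (x $ k)\<^sup>2)"
    by (metis add.commute le_add_same_cancel1 real_sqrt_abs real_sqrt_le_iff zero_le_one)
  also have "\<dots> \<le> sqrt (1 + (x $ k)\<^sup>2) * (\<Prod>j\<in>UNIV - {k}. sqrt (1 + (x $ j)\<^sup>2))"
    using mult_left_mono[OF prod_ge_1[of "UNIV - {k}" "\<lambda>j. sqrt (1 + (x $ j)\<^sup>2)"],
        of "sqrt (1 + (x $ k)\<^sup>2)"] by simp
  also have "\<dots> = constraint_prod x"
    unfolding constraint_prod_def by (subst (2) prod.remove[of _ k]) auto
  finally show ?thesis .
qed

lemma scale_to_constraint:
  assumes "y \<noteq> 0" "a \<ge> 0" "constraint_prod (a *\<^sub>R y) \<le> m"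
  obtains t where "t \<ge> a" "constraint_prod (t *\<^sub>R y) = m"
proof -
  obtain k where k: "y $ k \<noteq> 0"
    using assms(1) by (metis vec_eq_iff zero_index)
  \<comment> \<open>At \<open>b\<close> the coordinate \<open>k\<close> alone already has absolute
    value at least \<open>m\<close>; the intermediate value theorem then applies on
    \<open>{a..b}\<close>.\<close>
  define b where "b = max a (m / \<bar>y $ k\<bar>)"
  have "m \<ge> 0"
    using assms(3) constraint_prod_pos[of "a *\<^sub>R y"] by linarith
  have "m = m / \<bar>y $ k\<bar> * \<bar>y $ k\<bar>"
    using k by simp
  also have "\<dots> \<le> b * \<bar>y $ k\<bar>"
    unfolding b_def by (intro mult_right_mono) auto
  also have "\<dots> = \<bar>(b *\<^sub>R y) $ k\<bar>"
    using assms(2) by (simp add: b_def abs_mult)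
  also have "\<dots> \<le> constraint_prod (b *\<^sub>R y)"
    by (rule constraint_prod_ge)
  finally have "m \<le> constraint_prod (b *\<^sub>R y)" .
  moreover have "continuous_on {a..b} (\<lambda>t. constraint_prod (t *\<^sub>R y))"
    unfolding constraint_prod_def by (intro continuous_intros)
  moreover have "a \<le> b"
    by (simp add: b_def)
  ultimately show ?thesis
    using IVT'[of "\<lambda>t. constraint_prod (t *\<^sub>R y)" a m b] assms(3) that by auto
qed

text \<open>Some vector with distinct coordinates can be scaled onto the constraint surface, and the
  maximizer does at least as well as it.\<close>

lemma maximizes_discr_pos:
  fixes x :: "real ^ ('n :: {finite, linorder})"
  assumes "maximizes_discr m x" "m > 1"
  shows "discr x > 0"
proof (cases "x = 0")
  case True
  then show ?thesis
    using assms by (simp add: maximizes_discr_def constraint_prod_def)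
next
  case False
  obtain e :: "'n \<Rightarrow> nat" where e: "inj e"
    using finite_imp_inj_to_nat_seg[OF finite[of "UNIV :: 'n set"]] by blast
  \<comment> \<open>The injection into the naturals makes the coordinates distinct;
    \<open>Suc\<close> makes them nonzero, so that \<open>y\<close> can be scaled.\<close>
  define y where "y = (\<chi> k. real (Suc (e k)))"
  have "y \<noteq> 0"
    by (auto simp: y_def vec_eq_iff)
  moreover have "constraint_prod (0 *\<^sub>R y) \<le> m"
    using assms by (simp add: constraint_prod_def)
  ultimately obtain t where t: "t \<ge> 0" "constraint_prod (t *\<^sub>R y) = m"
    using scale_to_constraint[of y 0 m] by auto
  have "t \<noteq> 0"
    using t assms(2) by (auto simp: constraint_prod_def)
  then have "discr (t *\<^sub>R y) > 0"
    using e by (auto simp: discr_pos_iff y_def inj_def)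
  then show ?thesis
    using assms(1) t(2) unfolding maximizes_discr_def by fastforce
qed

text \<open>Dilating \<open>y\<close> by a factor of at least 1 reaches the surface without lowering
  the discriminant. This replaces the equality constraint by an inequality.\<close>

lemma maximizes_discr_relaxed:
  fixes x y :: "real ^ ('n :: {finite, linorder})"
  assumes "maximizes_discr m x" "constraint_prod y \<le> m" "y \<noteq> 0"
  shows "discr y \<le> discr x"
proof -
  obtain t where "t \<ge> 1" "constraint_prod (t *\<^sub>R y) = m"
    using scale_to_constraint[of y 1 m] assms by auto
  then show ?thesis
    using assms(1) discr_scaleR_mono[of t y] unfolding maximizes_discr_def by fastforce
qed

section \<open>Gradients of the two logarithmic functions and their directional derivatives\<close>

definition grad_discr :: "real ^ 'n \<Rightarrow> real ^ 'n" where
  "grad_discr x = (\<chi> k. \<Sum>j\<in>UNIV - {k}. 2 / (x $ k - x $ j))"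

definition grad_constraint :: "real ^ 'n \<Rightarrow> real ^ 'n" where
  "grad_constraint x = (\<chi> k. x $ k / (1 + (x $ k)\<^sup>2))"

lemma has_derivative_vec_component: "((\<lambda>y. y $ k) has_derivative (\<lambda>h. h $ k)) (at x)"
  by (rule bounded_linear_imp_has_derivative[OF bounded_linear_vec_nth])

lemma GDERIV_log_constraint: "GDERIV log_constraint x :> grad_constraint x"
proof -
  have "((\<lambda>y. 1 / 2 * (\<Sum>k\<in>UNIV. ln (1 + (y $ k)\<^sup>2))) has_derivative
      (\<lambda>h. 1 / 2 * (\<Sum>k\<in>UNIV. 2 * h $ k * x $ k / (1 + (x $ k)\<^sup>2)))) (at x)"
    by (auto intro!: derivative_eq_intros has_derivative_vec_component sum.cong
        simp: add_pos_nonneg divide_simps)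
  then show ?thesis
    unfolding gderiv_def log_constraint_def[abs_def]
    by (rule has_derivative_eq_rhs)
      (auto simp: inner_vec_def grad_constraint_def sum_distrib_left intro!: sum.cong)
qed

text \<open>The inner product with \<open>grad_discr x\<close> is a sum over all ordered pairs off
  the diagonal. Reflecting the part with \<open>k < j\<close> and merging it with the part
  \<open>j < k\<close> gives the derivative of the sum over \<open>j < k\<close>.\<close>

lemma GDERIV_log_discr:
  fixes x :: "real ^ ('n :: {finite, linorder})"
  assumes "\<And>j k. j \<noteq> k \<Longrightarrow> x $ j \<noteq> x $ k"
  shows "GDERIV log_discr x :> grad_discr x"
proof -
  let ?P = "{(j, k). j < k} :: ('n \<times> 'n) set"
  let ?Q = "{(j, k). k < j} :: ('n \<times> 'n) set"
  have "((\<lambda>y. ln ((y $ j - y $ k)\<^sup>2)) has_derivative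
      (\<lambda>h. 2 * (h $ j - h $ k) / (x $ j - x $ k))) (at x)" if "j < k" for j k
  proof -
    have "(x $ j - x $ k)\<^sup>2 > 0" "x $ j - x $ k \<noteq> 0"
      using assms[of j k] less_imp_neq[OF that] by auto
    then show ?thesis
      by (auto intro!: derivative_eq_intros has_derivative_vec_component
          simp: divide_simps) (auto simp: power2_eq_square)
  qed
  then have "(log_discr has_derivative
      (\<lambda>h. \<Sum>(j, k)\<in>?P. 2 * (h $ j - h $ k) / (x $ j - x $ k))) (at x)"
    unfolding log_discr_def[abs_def] case_prod_unfold by (intro has_derivative_sum) auto
  moreover have "(\<Sum>(j, k)\<in>?P. 2 * (h $ j - h $ k) / (x $ j - x $ k)) = h \<bullet> grad_discr x" for h
  proof -
    let ?F = "\<lambda>(j, k). h $ j * (2 / (x $ j - x $ k))"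
    have "h \<bullet> grad_discr x = (\<Sum>j\<in>UNIV. \<Sum>k\<in>UNIV - {j}. ?F (j, k))"
      by (simp add: inner_vec_def grad_discr_def sum_distrib_left)
    also have "\<dots> = sum ?F (SIGMA j:UNIV. UNIV - {j})"
      by (subst sum.Sigma) auto
    also have "(SIGMA j:UNIV. UNIV - {j}) = ?P \<union> ?Q"
      by (auto simp: neq_iff)
    also have "sum ?F (?P \<union> ?Q) = sum ?F ?P + sum ?F ?Q"
      by (intro sum.union_disjoint) (auto intro: finite_subset[OF subset_UNIV])
    also have "sum ?F ?Q = (\<Sum>(j, k)\<in>?P. ?F (k, j))"
      by (rule sum.reindex_bij_witness[of _ prod.swap prod.swap]) auto
    also have "sum ?F ?P + (\<Sum>(j, k)\<in>?P. ?F (k, j)) =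
        (\<Sum>(j, k)\<in>?P. 2 * (h $ j - h $ k) / (x $ j - x $ k))"
      unfolding sum.distrib[symmetric]
    proof (intro sum.cong refl, clarify)
      fix j k :: 'n
      assume "j < k"
      then have "x $ j - x $ k \<noteq> 0" "x $ k - x $ j \<noteq> 0"
        using assms[of j k] less_imp_neq by fastforce+
      then show "h $ j * (2 / (x $ j - x $ k)) + h $ k * (2 / (x $ k - x $ j)) =
          2 * (h $ j - h $ k) / (x $ j - x $ k)"
        by (simp add: divide_simps) (simp add: algebra_simps)
    qed
    finally show ?thesis ..
  qed
  ultimately show ?thesis
    unfolding gderiv_def by simp
qed

lemma GDERIV_at_line:
  assumes "GDERIV f x :> u"
  shows "((\<lambda>s. f (x + s *\<^sub>R w)) has_real_derivative w \<bullet> u) (at 0)"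
proof -
  have "(f has_derivative (\<lambda>h. h \<bullet> u)) (at (x + 0 *\<^sub>R w))"
    using assms by (simp add: gderiv_def)
  moreover have "((\<lambda>s. x + s *\<^sub>R w) has_derivative (\<lambda>s. s *\<^sub>R w)) (at (0 :: real))"
    by (auto intro!: derivative_eq_intros)
  ultimately have "((\<lambda>s. f (x + s *\<^sub>R w)) has_derivative (\<lambda>s. (s *\<^sub>R w) \<bullet> u)) (at 0)"
    using has_derivative_compose by blast
  then show ?thesis
    by (simp add: has_field_derivative_def mult.commute[of "w \<bullet> u"] mult_commute_abs)
qed

lemma GDERIV_unique_grad:
  assumes "GDERIV f x :> u" "GDERIV f x :> v"
  shows "u = v"
proof -
  have "(\<lambda>h. h \<bullet> u) = (\<lambda>h. h \<bullet> v)"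
    using has_derivative_unique assms unfolding gderiv_def by blast
  then have "(u - v) \<bullet> u = (u - v) \<bullet> v"
    by meson
  then have "(u - v) \<bullet> (u - v) = 0"
    by (simp add: inner_diff_right)
  then show ?thesis
    by simp
qed

text \<open>Let \<open>w\<close> be the component of \<open>u\<close> orthogonal to
  \<open>v\<close>. Tilting \<open>w\<close> slightly against \<open>v\<close> puts it into the open
  half-space, and letting the tilt tend to 0 gives \<open>w \<bullet> w \<le> 0\<close>.\<close>

lemma parallel_if_halfspace_subset:
  fixes u v :: "'a :: real_inner"
  assumes v: "v \<noteq> 0" and half: "\<And>w. w \<bullet> v < 0 \<Longrightarrow> w \<bullet> u \<le> 0"
  shows "u = ((u \<bullet> v) / (v \<bullet> v)) *\<^sub>R v"
proof -
  define c where "c = (u \<bullet> v) / (v \<bullet> v)"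
  define w where "w = u - c *\<^sub>R v"
  have wv: "w \<bullet> v = 0"
    using v by (simp add: w_def c_def inner_diff_left)
  have "w \<bullet> w \<le> e" if "e > 0" for e
  proof -
    \<comment> \<open>The tilt is small enough that \<open>s * (v \<bullet> u)\<close> is at most
      \<open>e\<close>; adding 1 keeps the denominator positive.\<close>
    define s where "s = e / (\<bar>v \<bullet> u\<bar> + 1)"
    have s: "s > 0" "s * (\<bar>v \<bullet> u\<bar> + 1) = e"
      using that by (auto simp: s_def add_nonneg_pos)
    have "(w - s *\<^sub>R v) \<bullet> v < 0"
      using v s(1) wv by (simp add: inner_diff_left)
    from half[OF this] have "w \<bullet> u \<le> s * (v \<bullet> u)"
      by (simp add: inner_diff_left)
    also have "\<dots> \<le> s * (\<bar>v \<bullet> u\<bar> + 1)"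
      using s(1) by (intro mult_left_mono) auto
    finally have "w \<bullet> u \<le> e"
      using s(2) by simp
    moreover have "w \<bullet> u = w \<bullet> w"
      using wv by (simp add: w_def inner_diff_right)
    ultimately show ?thesis
      by simp
  qed
  then have "w \<bullet> w \<le> 0"
    using field_le_epsilon[of "w \<bullet> w" 0] by simp
  then have "w = 0"
    by (metis inner_eq_zero_iff inner_ge_zero order.antisym)
  then show ?thesis
    by (simp add: w_def c_def)
qed

text \<open>Otherwise a short step along \<open>w\<close> would lower the constraint and raise the
  discriminant, against maximality on the region. Since the constraint may drop, no curve inside the
  surface has to be constructed.\<close>

lemma maximizes_discr_halfspace:
  fixes x w :: "real ^ ('n :: {finite, linorder})"
  assumes max: "maximizes_discr m x" and m: "m > 1"
    and w: "w \<bullet> grad_constraint x < 0"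
  shows "w \<bullet> grad_discr x \<le> 0"
proof (rule ccontr)
  assume "\<not> ?thesis"
  then have pos: "w \<bullet> grad_discr x > 0"
    by simp
  have x_pos: "discr x > 0"
    using maximizes_discr_pos[OF max m] .
  then have "GDERIV log_discr x :> grad_discr x"
    by (intro GDERIV_log_discr) (auto simp: discr_pos_iff)
  from DERIV_pos_inc_right[OF GDERIV_at_line[OF this] pos]
  obtain e1 where e1: "e1 > 0" "\<And>s. 0 < s \<Longrightarrow> s < e1 \<Longrightarrow> log_discr x < log_discr (x + s *\<^sub>R w)"
    by auto
  from DERIV_neg_dec_right[OF GDERIV_at_line[OF GDERIV_log_constraint] w]
  obtain e2 where e2: "e2 > 0"
    "\<And>s. 0 < s \<Longrightarrow> s < e2 \<Longrightarrow> log_constraint (x + s *\<^sub>R w) < log_constraint x"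
    by auto
  \<comment> \<open>The step must also keep the discriminant positive, because
    \<open>ln_discr\<close> identifies \<open>log_discr\<close> with its logarithm only
    there.\<close>
  have "continuous (at 0) (\<lambda>s. discr (x + s *\<^sub>R w))"
    unfolding discr_def case_prod_unfold by (intro continuous_intros)
  then have "((\<lambda>s. discr (x + s *\<^sub>R w)) \<longlongrightarrow> discr x) (at 0)"
    by (simp add: continuous_within)
  then have "\<forall>\<^sub>F s in at 0. discr (x + s *\<^sub>R w) > 0"
    using x_pos by (rule order_tendstoD)
  then obtain e3 where e3: "e3 > 0" "\<And>s. s \<noteq> 0 \<Longrightarrow> \<bar>s\<bar> < e3 \<Longrightarrow> discr (x + s *\<^sub>R w) > 0"
    unfolding eventually_at by (auto simp: dist_real_def)
  define s where "s = min e1 (min e2 e3) / 2"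
  have s: "0 < s" "s < e1" "s < e2" "s < e3"
    using e1(1) e2(1) e3(1) by (auto simp: s_def min_def)
  define y where "y = x + s *\<^sub>R w"
  have y_pos: "discr y > 0"
    using e3(2)[of s] s by (simp add: y_def)
  have "ln (constraint_prod y) < ln (constraint_prod x)"
    using e2(2)[of s] s by (simp add: y_def ln_constraint_prod)
  then have "constraint_prod y \<le> m"
    using max by (simp add: constraint_prod_pos maximizes_discr_def)
  have "ln (discr x) < ln (discr y)"
    using e1(2)[of s] s y_pos x_pos by (simp add: y_def ln_discr)
  then have less: "discr x < discr y"
    using x_pos y_pos by simp
  show False
  proof (cases "y = 0")
    \<comment> \<open>The zero vector is not covered by \<open>maximizes_discr_relaxed\<close>. With
      positive discriminant it forces a single index, and then every discriminant is the empty
      product.\<close>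
    case True
    then have "j = k" for j k :: 'n
      using y_pos unfolding discr_pos_iff by (metis zero_index)
    then have "{(j, k). j < k} = ({} :: ('n \<times> 'n) set)"
      by (metis (mono_tags, lifting) case_prodE less_irrefl mem_Collect_eq subsetI
          subset_empty)
    then have "discr y = discr x"
      by (simp add: discr_def)
    then show False
      using less by simp
  next
    case False
    then show False
      using maximizes_discr_relaxed[OF max \<open>constraint_prod y \<le> m\<close>] less by simp
  qed
qed

section \<open>The differential equation for the root polynomial\<close>

lemma prod_linear_coeffs:
  fixes x :: "'a \<Rightarrow> 'b :: idom"
  assumes "finite A"
  defines "P \<equiv> \<lambda>A. \<Prod>k\<in>A. [:- x k, 1:]"
  shows "degree (P A) = card A \<and> coeff (P A) (card A) = 1 \<and>
    (\<forall>n. card A = Suc n \<longrightarrow> coeff (P A) n = - sum x A) \<and>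
    (\<forall>n. card A = Suc (Suc n) \<longrightarrow>
      2 * coeff (P A) n = (sum x A)\<^sup>2 - (\<Sum>k\<in>A. (x k)\<^sup>2))"
  using assms(1)
proof (induction A rule: finite_induct)
  case empty
  then show ?case
    by (simp add: P_def)
next
  case (insert a A)
  \<comment> \<open>Each new coefficient combines two neighbouring old ones, so Vieta's formulas for
    the top three coefficients have to be proved in one induction.\<close>
  have step: "P (insert a A) = pCons 0 (P A) - smult (x a) (P A)"
    using insert.hyps by (simp add: P_def)
  have deg: "degree (P (insert a A)) = Suc (card A)"
  proof -
    have "P A \<noteq> 0"
      using insert.IH by auto
    then show ?thesis
      using insert by (simp add: P_def degree_mult_eq del: mult_pCons_left)
  qed
  have lead: "coeff (P (insert a A)) (Suc (card A)) = 1"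
    using insert.IH by (simp add: step coeff_eq_0)
  have snd: "coeff (P (insert a A)) n = - sum x (insert a A)" if "card A = n" for n
  proof (cases n)
    case 0
    then have "A = {}"
      using insert.hyps that by simp
    then show ?thesis
      using 0 by (simp add: P_def)
  next
    case (Suc k)
    then show ?thesis
      using insert that by (simp add: step)
  qed
  have "2 * coeff (P (insert a A)) n =
      (sum x (insert a A))\<^sup>2 - (\<Sum>k\<in>insert a A. (x k)\<^sup>2)" if "card A = Suc n" for n
  proof (cases n)
    case 0
    then have "card A = 1"
      using that by simp
    then obtain b where "A = {b}"
      by (rule card_1_singletonE)
    then show ?thesis
      using insert.hyps 0 by (simp add: step P_def power2_eq_square algebra_simps)
  next
    case (Suc k)
    then have "2 * coeff (P A) k = (sum x A)\<^sup>2 - (\<Sum>k\<in>A. (x k)\<^sup>2)"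
      "coeff (P A) n = - sum x A"
      using insert.IH that by auto
    then show ?thesis
      using insert.hyps Suc by (simp add: step power2_eq_square algebra_simps)
  qed
  then show ?case
    using deg lead snd insert.hyps by auto
qed

lemma root_poly_coeffs:
  fixes x :: "real ^ 'n"
  shows "degree (root_poly x) = CARD('n)"
    and "coeff (root_poly x) CARD('n) = 1"
    and "coeff (root_poly x) (CARD('n) - 1) = - (\<Sum>k\<in>UNIV. x $ k)"
    and "CARD('n) \<ge> 2 \<Longrightarrow> 2 * coeff (root_poly x) (CARD('n) - 2) =
      (\<Sum>k\<in>UNIV. x $ k)\<^sup>2 - (\<Sum>k\<in>UNIV. (x $ k)\<^sup>2)"
proof -
  note * = prod_linear_coeffs[of "UNIV :: 'n set" "\<lambda>k. x $ k", folded root_poly_def, simplified]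
  show "degree (root_poly x) = CARD('n)" "coeff (root_poly x) CARD('n) = 1"
    using * by auto
  show "coeff (root_poly x) (CARD('n) - 1) = - (\<Sum>k\<in>UNIV. x $ k)"
    using *[THEN conjunct2, THEN conjunct2, THEN conjunct1, rule_format, of "CARD('n) - 1"]
    by simp
  show "2 * coeff (root_poly x) (CARD('n) - 2) =
      (\<Sum>k\<in>UNIV. x $ k)\<^sup>2 - (\<Sum>k\<in>UNIV. (x $ k)\<^sup>2)" if "CARD('n) \<ge> 2"
    using *[THEN conjunct2, THEN conjunct2, THEN conjunct2, rule_format, of "CARD('n) - 2"] that
    by (simp add: Suc_diff_Suc numeral_2_eq_2)
qed

lemma cpoly_root_poly:
  fixes x :: "real ^ 'n"
  shows "cpoly (root_poly x) z = (\<Prod>k\<in>UNIV. z - of_real (x $ k))"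
proof -
  have add: "cpoly (p + q) z = cpoly p z + cpoly q z" for p q
  proof -
    have "map_poly complex_of_real (p + q) = map_poly of_real p + map_poly of_real q"
      by (rule poly_eqI) (simp add: coeff_map_poly)
    then show ?thesis
      by (simp add: cpoly_def)
  qed
  have linear: "cpoly ([:- a, 1:] * p) z = (z - of_real a) * cpoly p z" for a p
  proof -
    have "cpoly (smult (- a) p) z = - of_real a * cpoly p z"
      by (simp add: cpoly_def map_poly_smult del: smult_minus_left)
    moreover have "cpoly (pCons 0 p) z = z * cpoly p z"
      by (simp add: cpoly_def map_poly_pCons)
    ultimately show ?thesis
      using add[of "smult (- a) p" "pCons 0 p"] by (simp add: algebra_simps)
  qed
  have "cpoly (\<Prod>k\<in>A. [:- (x $ k), 1:]) z = (\<Prod>k\<in>A. z - of_real (x $ k))"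
    if "finite A" for A
    using that
  proof induction
    case empty
    then show ?case
      by (simp add: cpoly_def)
  next
    case (insert a A)
    then show ?case
      by (simp add: linear del: mult_pCons_left)
  qed
  then show ?thesis
    by (simp add: root_poly_def)
qed

text \<open>Each factor of \<open>f(i)\<close> has modulus \<open>sqrt (1 + t^2)\<close> for a root
  \<open>t\<close>, so the constraint is the condition on the modulus of
  \<open>f(i)\<close>.\<close>

lemma cmod_cpoly_root_poly_i: "cmod (cpoly (root_poly x) \<i>) = constraint_prod x"
proof -
  have "cmod (\<i> - of_real t) = sqrt (1 + t\<^sup>2)" for t
    by (simp add: cmod_def add.commute)
  then show ?thesis
    by (simp add: cpoly_root_poly constraint_prod_def flip: prod_norm)
qed

lemma cpoly_eq_sum_coeff:
  assumes "degree p \<le> n"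
  shows "cpoly p z = (\<Sum>i\<le>n. of_real (coeff p i) * z ^ i)"
proof -
  have "cpoly p z = (\<Sum>i\<le>degree p. of_real (coeff p i) * z ^ i)"
    by (simp add: cpoly_def poly_altdef coeff_map_poly degree_map_poly)
  also have "\<dots> = (\<Sum>i\<le>n. of_real (coeff p i) * z ^ i)"
    using assms by (intro sum.mono_neutral_left) (auto simp: coeff_eq_0)
  finally show ?thesis .
qed

text \<open>Writing \<open>f = (X - x_k) q\<close> gives \<open>f'(x_k) = q(x_k)\<close> and
  \<open>f''(x_k) = 2 q'(x_k)\<close>; the sum is twice the logarithmic derivative of
  \<open>q\<close> at \<open>x_k\<close>. This brings the critical point equations into terms of
  \<open>f\<close>.\<close>

lemma poly_pderiv2_root_poly:
  fixes x :: "real ^ 'n"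
  assumes "\<And>j k. j \<noteq> k \<Longrightarrow> x $ j \<noteq> x $ k"
  shows "poly (pderiv (pderiv (root_poly x))) (x $ k) =
    poly (pderiv (root_poly x)) (x $ k) * (\<Sum>j\<in>UNIV - {k}. 2 / (x $ k - x $ j))"
proof -
  define q where "q = (\<Prod>j\<in>UNIV - {k}. [:- (x $ j), 1:])"
  define L where "L = [:- (x $ k), 1:]"
  have f: "root_poly x = L * q"
    unfolding root_poly_def q_def L_def by (rule prod.remove) auto
  have L: "pderiv L = 1" "poly L (x $ k) = 0"
    by (simp_all add: L_def pderiv_pCons)
  have d1: "poly (pderiv (root_poly x)) (x $ k) = poly q (x $ k)"
    by (simp add: f pderiv_mult L)
  have d2: "poly (pderiv (pderiv (root_poly x))) (x $ k) = 2 * poly (pderiv q) (x $ k)"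
    by (simp add: f pderiv_mult pderiv_add L)
  have "poly (pderiv q) (x $ k) =
      (\<Sum>j\<in>UNIV - {k}. \<Prod>l\<in>UNIV - {k} - {j}. x $ k - x $ l)"
    by (simp add: q_def pderiv_prod pderiv_pCons poly_sum poly_prod)
  also have "\<dots> = (\<Sum>j\<in>UNIV - {k}. poly q (x $ k) / (x $ k - x $ j))"
  proof (intro sum.cong refl)
    fix j
    assume j: "j \<in> UNIV - {k}"
    then have "poly q (x $ k) = (x $ k - x $ j) * (\<Prod>l\<in>UNIV - {k} - {j}. x $ k - x $ l)"
      by (simp add: q_def poly_prod) (subst prod.remove[of _ j]; simp)
    then show "(\<Prod>l\<in>UNIV - {k} - {j}. x $ k - x $ l) = poly q (x $ k) / (x $ k - x $ j)"
      using assms[of j k] j by simp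
  qed
  finally show ?thesis
    unfolding d1 d2 by (simp add: sum_distrib_left mult.commute)
qed

section \<open>The differential operator and its recurrence for coefficients\<close>

definition ode_poly :: "real \<Rightarrow> real \<Rightarrow> real poly \<Rightarrow> real poly" where
  "ode_poly l c f = [:1, 0, 1:] * pderiv (pderiv f) - smult l ([:0, 1:] * pderiv f) - smult c f"

lemma coeff_ode_poly:
  "coeff (ode_poly l c f) k = real (k + 2) * real (k + 1) * coeff f (k + 2) +
    (real k * (real k - 1) - l * real k - c) * coeff f k"
proof -
  \<comment> \<open>The part \<open>X^2 * f''\<close> contributes nothing at indices 0 and 1, so
    these are computed apart.\<close>
  consider "k = 0" | "k = 1" | n where "k = Suc (Suc n)"
    by (metis One_nat_def old.nat.exhaust)
  then show ?thesis
    by cases (simp_all add: ode_poly_def coeff_pderiv algebra_simps)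
qed

text \<open>The polynomial has degree less than \<open>d\<close>, and the critical point equations say that it
  vanishes at the \<open>d\<close> roots of \<open>f\<close>.\<close>

lemma ode_poly_root_poly_eq_0:
  fixes x :: "real ^ 'n"
  defines "d \<equiv> real CARD('n)"
  assumes distinct: "\<And>j k. j \<noteq> k \<Longrightarrow> x $ j \<noteq> x $ k"
    and crit: "\<And>k. (\<Sum>j\<in>UNIV - {k}. 2 / (x $ k - x $ j)) = l * (x $ k / (1 + (x $ k)\<^sup>2))"
  shows "ode_poly l (d * (d - 1 - l)) (root_poly x) = 0"
proof (rule ccontr)
  let ?f = "root_poly x"
  let ?p = "ode_poly l (d * (d - 1 - l)) ?f"
  assume nz: "?p \<noteq> 0"
  \<comment> \<open>The constant \<open>d * (d - 1 - l)\<close> is the one that cancels the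
    coefficient of \<open>X^d\<close>; beyond \<open>d\<close> all coefficients of \<open>f\<close>
    vanish.\<close>
  have coeff_0: "coeff ?p k = 0" if "k \<ge> CARD('n)" for k
  proof (cases "k = CARD('n)")
    case True
    then show ?thesis
      by (simp add: coeff_ode_poly coeff_eq_0 root_poly_coeffs d_def algebra_simps)
  next
    case False
    then show ?thesis
      using that by (simp add: coeff_ode_poly coeff_eq_0 root_poly_coeffs)
  qed
  have "degree ?p < CARD('n)"
    using coeff_0[of "degree ?p"] nz by (force simp: not_less)
  \<comment> \<open>At a root the term in \<open>f\<close> drops out, and \<open>crit\<close> times
    \<open>1 + x_k^2\<close> turns the second-order term into
    \<open>l * x_k * f'(x_k)\<close>.\<close>
  moreover have "poly ?p (x $ k) = 0" for k
  proof -
    have "poly ?f (x $ k) = 0"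
      by (auto simp: root_poly_def poly_prod)
    moreover have "1 + (x $ k)\<^sup>2 \<noteq> 0"
      by (smt (verit) zero_le_power2)
    ultimately show ?thesis
      using poly_pderiv2_root_poly[OF distinct, of k] crit[of k]
      by (simp add: ode_poly_def power2_eq_square field_simps)
  qed
  then have "range (\<lambda>k. x $ k) \<subseteq> {t. poly ?p t = 0}"
    by auto
  then have "card (range (\<lambda>k. x $ k)) \<le> card {t. poly ?p t = 0}"
    using nz by (intro card_mono poly_roots_finite)
  moreover have "card (range (\<lambda>k. x $ k)) = CARD('n)"
    using distinct by (intro card_image) (auto simp: inj_on_def)
  moreover have "card {t. poly ?p t = 0} \<le> degree ?p"
    using nz by (rule card_poly_roots_bound)
  ultimately show False
    by simp
qed

text \<open>Comparison of coefficients at \<open>X^(d - 1)\<close>, where the contribution of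
  \<open>coeff f (d + 1)\<close> is zero.\<close>

lemma ode_poly_top_coeff:
  assumes "ode_poly l (real d * (real d - 1 - l)) f = 0" "degree f = d" "d \<ge> 1"
  shows "(2 * real d - 2 - l) * coeff f (d - 1) = 0"
proof -
  have "coeff f (d + 1) = 0"
    using assms(2) by (simp add: coeff_eq_0)
  moreover have "d - 1 + 2 = d + 1"
    using assms(3) by simp
  ultimately show ?thesis
    using coeff_ode_poly[of l "real d * (real d - 1 - l)" f "d - 1"] assms
    by (simp add: of_nat_diff algebra_simps)
qed

text \<open>With \<open>k = d - (n + 2)\<close>, the factor
  \<open>k (k - 1) - l k - d (d - 1 - l)\<close> splits as \<open>(k - d) (k + d - 1 - l)\<close>.
  Counting from the top makes the recurrence start at the known leading coefficient.\<close>

lemma ode_poly_coeff_rec: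
  assumes "ode_poly l (real d * (real d - 1 - l)) f = 0" "n + 2 \<le> d"
  shows "(real d - real n) * (real d - real n - 1) * coeff f (d - n) =
    (real n + 2) * (2 * real d - real n - 3 - l) * coeff f (d - (n + 2))"
proof -
  obtain e where "d = e + (n + 2)"
    using assms(2) by (metis le_add_diff_inverse2)
  then show ?thesis
    using coeff_ode_poly[of l "real d * (real d - 1 - l)" f e] assms
    by (simp add: algebra_simps)
qed

text \<open>Two absorption steps. The left factor is that of the coefficient recurrence, so the
  binomial can be split off from its solution.\<close>

lemma choose_add_2:
  assumes "n + 2 \<le> d"
  shows "(real d - real n) * (real d - real n - 1) * real (d choose n) =
    (real n + 2) * (real n + 1) * real (d choose (n + 2))"
proof -
  have *: "real (Suc k) * real (d choose Suc k) = (real d - real k) * real (d choose k)"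
    if "k \<le> d" for k
  proof -
    have "Suc k * (d choose Suc k) = (d - k) * (d choose k)"
      using binomial_absorption[of k d] binomial_absorb_comp[of d k] by simp
    then have "real (Suc k * (d choose Suc k)) = real ((d - k) * (d choose k))"
      by (rule arg_cong)
    then show ?thesis
      using that by (simp only: of_nat_mult of_nat_diff)
  qed
  have "(real d - real n) * (real d - real n - 1) * real (d choose n) =
      (real d - real (Suc n)) * ((real d - real n) * real (d choose n))"
    by simp
  also have "\<dots> = real (Suc n) * ((real d - real (Suc n)) * real (d choose Suc n))"
    using *[of n] assms by simp
  also have "\<dots> = real (Suc n) * (real (Suc (Suc n)) * real (d choose Suc (Suc n)))"
    using *[of "Suc n"] assms by simp
  finally show ?thesis
    by (simp add: algebra_simps)
qed

section \<open>Solving the recurrence\<close>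

lemma even_rec_solution:
  fixes b :: "nat \<Rightarrow> real"
  assumes "b 0 = 1" and l: "l > 2 * real d - 3"
    and rec: "\<And>n. n + 2 \<le> d \<Longrightarrow> (real d - real n) * (real d - real n - 1) * b n =
      (real n + 2) * (2 * real d - real n - 3 - l) * b (n + 2)"
  shows "2 * k \<le> d \<Longrightarrow> b (2 * k) =
    real (d choose (2 * k)) * (\<Prod>j = 1..k. (2 * real j - 1) / (2 * real d - 2 * real j - 1 - l))"
proof (induction k)
  case 0
  then show ?case
    using assms(1) by simp
next
  case (Suc k)
  define P where "P = (\<Prod>j = 1..k. (2 * real j - 1) / (2 * real d - 2 * real j - 1 - l))"
  define c where "c = 2 * real d - 2 * real k - 3 - l"
  \<comment> \<open>The bound on \<open>l\<close> makes \<open>c\<close> negative.\<close>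
  have c: "c \<noteq> 0"
    using l by (simp add: c_def)
  have le: "2 * k + 2 \<le> d"
    using Suc.prems by simp
  have "(2 * real k + 2) * c * b (2 * k + 2) =
      (real d - real (2 * k)) * (real d - real (2 * k) - 1) * real (d choose (2 * k)) * P"
    using rec[OF le] Suc.IH le by (simp add: c_def P_def)
  also have "\<dots> = (2 * real k + 2) * (2 * real k + 1) * real (d choose (2 * k + 2)) * P"
    using choose_add_2[OF le] by simp
  finally have "c * b (2 * k + 2) = (2 * real k + 1) * real (d choose (2 * k + 2)) * P"
    by (simp add: mult.assoc)
  then have "b (2 * k + 2) = real (d choose (2 * k + 2)) * (P * ((2 * real k + 1) / c))"
    using c by (simp add: field_simps)
  moreover have "(\<Prod>j = 1..Suc k. (2 * real j - 1) / (2 * real d - 2 * real j - 1 - l)) =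
      P * ((2 * real k + 1) / c)"
    by (simp add: P_def c_def algebra_simps)
  ultimately show ?case
    by simp
qed

lemma odd_rec_solution:
  fixes b :: "nat \<Rightarrow> real"
  assumes "b 1 = 0" and l: "l > 2 * real d - 3"
    and rec: "\<And>n. n + 2 \<le> d \<Longrightarrow> (real d - real n) * (real d - real n - 1) * b n =
      (real n + 2) * (2 * real d - real n - 3 - l) * b (n + 2)"
  shows "2 * k + 1 \<le> d \<Longrightarrow> b (2 * k + 1) = 0"
proof (induction k)
  case 0
  then show ?case
    using assms(1) by simp
next
  case (Suc k)
  have le: "(2 * k + 1) + 2 \<le> d"
    using Suc.prems by simp
  have "2 * real d - real (2 * k + 1) - 3 - l \<noteq> 0" "real (2 * k + 1) + 2 \<noteq> 0"
    using l by simp_all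
  then have "b ((2 * k + 1) + 2) = 0"
    using rec[OF le] Suc.IH le by simp
  then show ?case
    by simp
qed

text \<open>At \<open>l = 2 d - 2\<close> the recurrence for the coefficients becomes that of
  \<open>(X + i)\<^sup>d\<close> and \<open>(X - i)\<^sup>d\<close>.\<close>

lemma degenerate_rec_solution:
  fixes b :: "nat \<Rightarrow> real"
  assumes "b 0 = 1" and d: "d \<ge> 1"
    and rec: "\<And>n. n + 2 \<le> d \<Longrightarrow> (real d - real n) * (real d - real n - 1) * b n =
      - (real n + 2) * (real n + 1) * b (n + 2)"
  shows "n \<le> d \<Longrightarrow> complex_of_real (b n) = of_nat (d choose n) / (2 * of_nat d) *
    ((of_nat d - of_real (b 1) * \<i>) * \<i> ^ n + (of_nat d + of_real (b 1) * \<i>) * (- \<i>) ^ n)"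
proof (induction n rule: induct_nat_012)
  case 0
  then show ?case
    using assms(1) d by (simp add: field_simps)
next
  case 1
  then show ?case
    using d by (simp add: field_simps)
next
  case (ge2 n)
  \<comment> \<open>Raising \<open>n\<close> by 2 turns this bracket into \<open>- A\<close>, since
    \<open>i\<close> and \<open>-i\<close> both have square -1; this absorbs the sign in the
    recurrence.\<close>
  define A where "A = (of_nat d - of_real (b 1) * \<i>) * \<i> ^ n +
    (of_nat d + of_real (b 1) * \<i>) * (- \<i>) ^ n"
  define q :: complex where "q = (of_nat n + 2) * (of_nat n + 1)"
  have le: "n + 2 \<le> d"
    using ge2.prems by simp
  have q: "q \<noteq> 0"
  proof -
    have "q = of_nat ((n + 2) * (n + 1))"
      by (simp add: q_def algebra_simps)
    then show ?thesis
      by (metis add_2_eq_Suc' add_is_0 mult_is_0 nat.distinct(1) of_nat_eq_0_iff one_neq_zero)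
  qed
  have "- q * of_real (b (n + 2)) = of_real (- (real n + 2) * (real n + 1) * b (n + 2))"
    by (simp add: q_def algebra_simps)
  also have "\<dots> = of_real ((real d - real n) * (real d - real n - 1)) * of_real (b n)"
    using rec[OF le] by (metis of_real_mult)
  also have "of_real (b n) = of_nat (d choose n) / (2 * of_nat d) * A"
    using ge2.IH(1) le by (simp add: A_def)
  also have "of_real ((real d - real n) * (real d - real n - 1)) * \<dots> =
      of_real ((real d - real n) * (real d - real n - 1) * real (d choose n)) * (A / (2 * of_nat d))"
    by simp
  also have "\<dots> = q * of_nat (d choose (n + 2)) * (A / (2 * of_nat d))"
    by (subst choose_add_2[OF le]) (simp add: q_def)
  finally have "q * of_real (b (n + 2)) =
      q * (of_nat (d choose (n + 2)) / (2 * of_nat d) * (- A))"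
    by (simp add: minus_equation_iff[of "q * _"] ac_simps)
  then have "of_real (b (n + 2)) = of_nat (d choose (n + 2)) / (2 * of_nat d) * (- A)"
    using q mult_left_cancel by blast
  moreover have "- A = (of_nat d - of_real (b 1) * \<i>) * \<i> ^ (n + 2) +
    (of_nat d + of_real (b 1) * \<i>) * (- \<i>) ^ (n + 2)"
    by (simp add: A_def power_add algebra_simps)
  ultimately show ?case
    by simp
qed

section \<open>From the coefficients back to closed forms of the polynomial\<close>

lemma sum_atMost_even:
  fixes g :: "nat \<Rightarrow> 'a :: comm_monoid_add"
  assumes "\<And>n. n \<le> d \<Longrightarrow> odd n \<Longrightarrow> g n = 0"
  shows "(\<Sum>n\<le>d. g n) = (\<Sum>k\<le>d div 2. g (2 * k))"
proof -
  have "(\<Sum>n\<le>d. g n) = sum g ((*) 2 ` {..d div 2})"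
  proof (intro sum.mono_neutral_right ballI)
    fix n
    assume n: "n \<in> {..d} - (*) 2 ` {..d div 2}"
    have "odd n"
    proof
      assume "even n"
      then have "n = 2 * (n div 2)" "n div 2 \<le> d div 2"
        using n by (auto intro: div_le_mono)
      then show False
        using n by blast
    qed
    then show "g n = 0"
      using assms n by simp
  qed auto
  also have "\<dots> = (\<Sum>k\<le>d div 2. g (2 * k))"
    by (subst sum.reindex) (auto simp: inj_on_def)
  finally show ?thesis .
qed

lemma sum_rev_atMost:
  fixes g :: "nat \<Rightarrow> 'a :: comm_monoid_add"
  shows "(\<Sum>i\<le>d. g i) = (\<Sum>n\<le>d. g (d - n))"
  by (rule sum.reindex_bij_witness[of _ "\<lambda>n. d - n" "\<lambda>n. d - n"]) auto

lemma power_add_sum_rev: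
  fixes z w :: "'a :: comm_semiring_1"
  shows "(z + w) ^ d = (\<Sum>n\<le>d. of_nat (d choose n) * w ^ n * z ^ (d - n))"
  by (subst add.commute) (simp add: binomial_ring)

text \<open>As \<open>l\<close> differs from \<open>2 d - 2\<close>, the coefficient of
  \<open>X^(d - 1)\<close> vanishes and with it the whole odd chain; the even chain starts at
  1.\<close>

lemma poly_ode_solution_generic:
  assumes "ode_poly l (real d * (real d - 1 - l)) f = 0" "degree f = d" "coeff f d = 1"
    and "d \<ge> 1" "l \<noteq> 2 * real d - 2" "l > 2 * real d - 3"
  shows "poly f t = t ^ d + (\<Sum>k = 1..d div 2. (real (d choose (2 * k)) *
    (\<Prod>j = 1..k. (2 * real j - 1) / (2 * real d - 2 * real j - 1 - l))) * t ^ (d - 2 * k))"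
proof -
  let ?c = "\<lambda>k. real (d choose (2 * k)) *
    (\<Prod>j = 1..k. (2 * real j - 1) / (2 * real d - 2 * real j - 1 - l))"
  define b where "b n = coeff f (d - n)" for n
  have b0: "b 0 = 1"
    using assms by (simp add: b_def)
  have b1: "b 1 = 0"
    using ode_poly_top_coeff[OF assms(1,2,4)] assms(5) by (simp add: b_def)
  have rec: "(real d - real n) * (real d - real n - 1) * b n =
      (real n + 2) * (2 * real d - real n - 3 - l) * b (n + 2)" if "n + 2 \<le> d" for n
    using ode_poly_coeff_rec[OF assms(1) that] by (simp add: b_def)
  have odd: "b n = 0" if "n \<le> d" "odd n" for n
    using odd_rec_solution[of b d l, OF b1 assms(6) rec] that by (auto elim!: oddE)
  have even: "b (2 * k) = ?c k" if "2 * k \<le> d" for k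
    using even_rec_solution[of b d l, OF b0 assms(6) rec that] .
  have "poly f t = (\<Sum>n\<le>d. b n * t ^ (d - n))"
    unfolding poly_altdef assms(2) b_def by (rule sum_rev_atMost)
  also have "\<dots> = (\<Sum>k\<le>d div 2. b (2 * k) * t ^ (d - 2 * k))"
    by (intro sum_atMost_even) (simp add: odd)
  also have "\<dots> = (\<Sum>k\<le>d div 2. ?c k * t ^ (d - 2 * k))"
    using even by (intro sum.cong) auto
  also have "\<dots> = t ^ d + (\<Sum>k = 1..d div 2. ?c k * t ^ (d - 2 * k))"
    by (simp add: atMost_atLeast0 sum.atLeast_Suc_atMost)
  finally show ?thesis .
qed

text \<open>Here \<open>2 d - n - 3 - l = - (n + 1)\<close>, and the solved coefficients assemble
  into two binomial expansions weighted by \<open>?u\<close> and \<open>?v\<close>.\<close>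

lemma cpoly_ode_solution_degenerate:
  assumes "ode_poly l (real d * (real d - 1 - l)) f = 0" "degree f = d" "coeff f d = 1"
    and "d \<ge> 1" "l = 2 * real d - 2"
  defines "B \<equiv> coeff f (d - 1)"
  shows "cpoly f z = 1 / (2 * of_nat d) *
    ((of_nat d - of_real B * \<i>) * (z + \<i>) ^ d + (of_nat d + of_real B * \<i>) * (z - \<i>) ^ d)"
proof -
  define b where "b n = coeff f (d - n)" for n
  let ?u = "of_nat d - of_real B * \<i>" and ?v = "of_nat d + of_real B * \<i>"
  have rec: "(real d - real n) * (real d - real n - 1) * b n =
      - (real n + 2) * (real n + 1) * b (n + 2)" if "n + 2 \<le> d" for n
  proof -
    have "2 * real d - real n - 3 - l = - (real n + 1)"
      using assms(5) by simp
    then show ?thesis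
      using ode_poly_coeff_rec[OF assms(1) that]
      by (simp only: b_def)
  qed
  have b: "complex_of_real (b n) =
      of_nat (d choose n) / (2 * of_nat d) * (?u * \<i> ^ n + ?v * (- \<i>) ^ n)" if "n \<le> d" for n
    using degenerate_rec_solution[of b d, OF _ assms(4) rec that] assms(3)
    by (simp add: b_def B_def)
  have "cpoly f z = (\<Sum>n\<le>d. of_real (b n) * z ^ (d - n))"
    unfolding b_def by (subst cpoly_eq_sum_coeff[of _ d]) (use assms(2) sum_rev_atMost in auto)
  also have "\<dots> = (\<Sum>n\<le>d. 1 / (2 * of_nat d) *
      (?u * (of_nat (d choose n) * \<i> ^ n * z ^ (d - n)) +
       ?v * (of_nat (d choose n) * (- \<i>) ^ n * z ^ (d - n))))"
    by (intro sum.cong refl) (simp add: b algebra_simps add_divide_distrib)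
  also have "\<dots> = 1 / (2 * of_nat d) * (?u * (z + \<i>) ^ d + ?v * (z + - \<i>) ^ d)"
    by (simp only: power_add_sum_rev sum_distrib_left[symmetric] sum.distrib)
  finally show ?thesis
    by simp
qed

lemma lagrange_multiplier_iff:
  fixes x :: "real ^ ('n :: {finite, linorder})"
  assumes "\<And>j k. j \<noteq> k \<Longrightarrow> x $ j \<noteq> x $ k"
  shows "lagrange_multiplier x l \<longleftrightarrow> grad_discr x = l *\<^sub>R grad_constraint x"
  unfolding lagrange_multiplier_def
  using GDERIV_log_discr[OF assms] GDERIV_log_constraint GDERIV_unique_grad by metis

text \<open>The gradient vanishes only at the origin, where the product is 1. Nonvanishing gives
  both existence and uniqueness of the multiplier.\<close>

lemma grad_constraint_nonzero:
  assumes "constraint_prod x > 1"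
  shows "grad_constraint x \<noteq> 0"
proof
  assume 0: "grad_constraint x = 0"
  have "x $ k = 0" for k
  proof -
    have "x $ k / (1 + (x $ k)\<^sup>2) = 0"
      using 0 by (metis grad_constraint_def vec_lambda_beta zero_index)
    moreover have "1 + (x $ k)\<^sup>2 \<noteq> 0"
      by (smt (verit) zero_le_power2)
    ultimately show ?thesis
      by simp
  qed
  then show False
    using assms by (simp add: constraint_prod_def)
qed

theorem theorem13:
  fixes d :: nat and m :: real
    and x :: "real ^ ('n :: {finite, linorder})"
    and f :: "real poly"
  assumes "d = CARD('n)" and "d \<ge> 2" and "m > 1"
    and "maximizes_discr m x"
    and "f = root_poly x"
  shows "(\<exists>!lam. lagrange_multiplier x lam) \<and>
    (\<forall>lam. lagrange_multiplier x lam \<longrightarrow>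
      (lam \<noteq> 2 * real d - 2 \<longrightarrow>
         lam > 2 * real d - 3 \<and>
         (\<forall>t. poly f t = t ^ d +
            (\<Sum>k = 1..d div 2.
               (real (d choose (2 * k)) *
                (\<Prod>j = 1..k. (2 * real j - 1) / (2 * real d - 2 * real j - 1 - lam))) *
               t ^ (d - 2 * k))) \<and>
         cmod (cpoly f \<i>) = m) \<and>
      (lam = 2 * real d - 2 \<longrightarrow>
         (\<exists>B :: real. B = coeff f (d - 1) \<and>
            (\<forall>z. cpoly f z = 1 / (2 * of_nat d) *
               ((of_nat d - of_real B * \<i>) * (z + \<i>) ^ d +
                (of_nat d + of_real B * \<i>) * (z - \<i>) ^ d)) \<and>
            cmod (cpoly f \<i>) = m)))"
proof -
  have distinct: "x $ j \<noteq> x $ k" if "j \<noteq> k" for j k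
    using maximizes_discr_pos[OF assms(4,3)] that by (auto simp: discr_pos_iff)
  then have mult_iff: "lagrange_multiplier x lam \<longleftrightarrow> grad_discr x = lam *\<^sub>R grad_constraint x"
    for lam
    by (rule lagrange_multiplier_iff)
  have m: "constraint_prod x = m"
    using assms(4) by (simp add: maximizes_discr_def)
  then have nz: "grad_constraint x \<noteq> 0"
    using assms(3) grad_constraint_nonzero by blast
  have "\<exists>!lam. lagrange_multiplier x lam"
  proof (rule ex_ex1I)
    have "grad_discr x = ((grad_discr x \<bullet> grad_constraint x) /
        (grad_constraint x \<bullet> grad_constraint x)) *\<^sub>R grad_constraint x"
      by (intro parallel_if_halfspace_subset nz maximizes_discr_halfspace[OF assms(4,3)])
    then show "\<exists>lam. lagrange_multiplier x lam"
      by (intro exI) (simp only: mult_iff)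
    show "a = b" if "lagrange_multiplier x a" "lagrange_multiplier x b" for a b
      using that nz unfolding mult_iff by simp
  qed
  moreover have cmod: "cmod (cpoly f \<i>) = m"
    using m assms(5) by (simp add: cmod_cpoly_root_poly_i)
  moreover have d1: "d \<ge> 1"
    using assms(2) by simp
  have deg: "degree f = d" "coeff f d = 1"
    using assms(1,5) by (simp_all add: root_poly_coeffs)
  have ode: "ode_poly lam (real d * (real d - 1 - lam)) f = 0"
    if "lagrange_multiplier x lam" for lam
    unfolding assms(1,5)
  proof (rule ode_poly_root_poly_eq_0[OF distinct])
    fix k
    have "grad_discr x $ k = (lam *\<^sub>R grad_constraint x) $ k"
      using that by (simp add: mult_iff)
    then show "(\<Sum>j\<in>UNIV - {k}. 2 / (x $ k - x $ j)) = lam * (x $ k / (1 + (x $ k)\<^sup>2))"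
      by (simp add: grad_discr_def grad_constraint_def)
  qed auto
  have bound: "lam > 2 * real d - 3"
    if "lagrange_multiplier x lam" "lam \<noteq> 2 * real d - 2" for lam
  proof -
    note ode' = ode[OF that(1)]
    have "coeff f (d - 1) = 0"
      using ode_poly_top_coeff[OF ode' deg(1) d1] that(2) by simp
    then have "(\<Sum>k\<in>UNIV. x $ k) = 0"
      using assms(1,5) root_poly_coeffs(3)[of x] by simp
    then have e2: "2 * coeff f (d - 2) = - (\<Sum>k\<in>UNIV. (x $ k)\<^sup>2)"
      using assms(1,2,5) root_poly_coeffs(4)[of x] by simp
    have "x \<noteq> 0"
      using m assms(3) by (auto simp: constraint_prod_def)
    then obtain k where "x $ k \<noteq> 0"
      by (metis vec_eq_iff zero_index)
    then have "(\<Sum>k\<in>UNIV. (x $ k)\<^sup>2) > 0"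
      by (intro sum_pos2[of _ k]) auto
    then have neg: "coeff f (d - 2) < 0"
      using e2 by simp
    \<comment> \<open>This is the recurrence at \<open>n = 0\<close> with leading coefficient 1. Its
      left side is positive and \<open>coeff f (d - 2)\<close> negative, so
      \<open>2 d - 3 - lam\<close> must be negative.\<close>
    have "real d * (real d - 1) = 2 * (2 * real d - 3 - lam) * coeff f (d - 2)"
      using ode_poly_coeff_rec[OF ode', of 0] deg assms(2)
      by (simp del: add_2_eq_Suc add_2_eq_Suc')
    moreover have "real d * (real d - 1) > 0"
      using assms(2) by simp
    ultimately have "2 * (2 * real d - 3 - lam) * coeff f (d - 2) > 0"
      by simp
    then show ?thesis
      using neg by (simp add: zero_less_mult_iff)
  qed
  ultimately show ?thesis
    using poly_ode_solution_generic[OF ode deg d1] cpoly_ode_solution_degenerate[OF ode deg d1]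
    by blast
qed

end
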